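(* Let $0<\tau\le1$ and let $\mathcal{T}$ be a set of primes such that \[ \sum_{p\notin\mathcal{T},\ p\le y}\frac{\log p}{\sqrt p}\ \gg_\tau\ y^{1/2} \] (i.e. this sum is at least $c(\tau)\,y^{1/2}$ for some constant $c(\tau)>0$ and all sufficiently large $y$). Let $\mathcal{S}=\{n\in\mathbb{N}:\ p\mid n\Rightarrow p\in\mathcal{T} \text{ for every prime } p\}$. Let $F_4(N)$ denote the largest dimension $d$ such that there exist a non-negative integer $a_0$ and positive integers $a_1,\dots,a_d$ with $\mathcal{H}(a_0;a_1,\dots,a_d)\subset\mathcal{S}\cap[1,N]$. Then $F_4(N)\ll_{\mathcal{T}}\log N$.
   Context: The Hilbert cube is $\mathcal{H}(a_0;a_1,\dots,a_d)=\{a_0+\sum_{i\in I}a_i:\ I\subseteq\{1,\dots,d\}\}$. $X\ll_{\mathcal{T}}Y$ means $X\le CY$ with $C$ depending only on $\mathcal{T}$ (for all sufficiently large $N$). *)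

theory Defs
  imports "HOL-Computational_Algebra.Primes" Complex_Main
begin

definition hilbert_cube :: "nat \<Rightarrow> (nat \<Rightarrow> nat) \<Rightarrow> nat \<Rightarrow> nat set" where
  "hilbert_cube a0 a d = {a0 + (\<Sum>i\<in>I. a i) | I. I \<subseteq> {1..d}}"

definition smooth_set :: "nat set \<Rightarrow> nat set" where
  "smooth_set T = {n. n > 0 \<and> (\<forall>p. prime p \<longrightarrow> p dvd n \<longrightarrow> p \<in> T)}"

text \<open>The \<open>a i\<close> need not be distinct.\<close>

definition cube_dims :: "nat set \<Rightarrow> nat \<Rightarrow> nat set" where
  "cube_dims T N = {d. \<exists>a0 a. (\<forall>i\<in>{1..d}. a i > 0) \<and>
                        hilbert_cube a0 a d \<subseteq> smooth_set T \<inter> {1..N}}"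

definition F4 :: "nat set \<Rightarrow> nat \<Rightarrow> nat" where
  "F4 T N = Max (cube_dims T N)"

text \<open>The maximum defining \<open>F4\<close> is that of a finite set, nonempty for \<open>N \<ge> 1\<close>.\<close>

lemma cube_dims_le: "d \<in> cube_dims T N \<Longrightarrow> d \<le> N"
proof -
  assume "d \<in> cube_dims T N"
  then obtain a0 a where pos: "\<forall>i\<in>{1..d}. a i > (0::nat)"
    and sub: "hilbert_cube a0 a d \<subseteq> smooth_set T \<inter> {1..N}"
    unfolding cube_dims_def by blast
  have "a0 + (\<Sum>i\<in>{1..d}. a i) \<in> hilbert_cube a0 a d"
    unfolding hilbert_cube_def by blast
  with sub have "a0 + (\<Sum>i\<in>{1..d}. a i) \<le> N" by auto
  moreover have "(\<Sum>i\<in>{1..d}. 1) \<le> (\<Sum>i\<in>{1..d}. a i)"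
    using pos by (intro sum_mono) (auto simp: Suc_le_eq)
  ultimately show "d \<le> N" by simp
qed

lemma finite_cube_dims: "finite (cube_dims T N)"
  by (rule finite_subset[of _ "{..N}"]) (auto dest: cube_dims_le)

lemma zero_in_cube_dims: "N \<ge> 1 \<Longrightarrow> 0 \<in> cube_dims T N"
  unfolding cube_dims_def hilbert_cube_def smooth_set_def
  by (auto intro!: exI[of _ "1::nat"])

end

theory Submission
  imports Defs
begin

text \<open>
  Let \<open>p \<notin> T\<close> be a prime. The cube avoids the residue \<open>0\<close> modulo \<open>p\<close>, whereas \<open>p - 1\<close> steps
  prime to \<open>p\<close> already produce all residues, since each such step enlarges the set of residues
  reached so far. So \<open>p\<close> divides at least half of the \<open>a\<^sub>i\<close> as soon as \<open>2 p \<le> d\<close>. As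
  \<open>a\<^sub>i \<le> N\<close>, double counting gives \<open>\<Sum> ln p \<le> 2 ln N\<close> over the primes \<open>p \<notin> T\<close> with
  \<open>p \<le> d/2\<close>. On the other hand, Chebyshev's upper bound shows that the primes below \<open>\<epsilon> d\<close>
  contribute little to \<open>\<Sum> ln p / sqrt p\<close>, so the hypothesis on \<open>T\<close> makes the former sum
  \<open>\<gg> d\<close>.
\<close>

section \<open>Chebyshev-type upper bounds for sums over primes\<close>

text \<open>Distinct primes are coprime, so their product divides \<open>a\<close>; take logarithms.
  It serves both for a binomial coefficient and for the steps of the cube.\<close>

lemma sum_ln_primes_dvd_le:
  fixes a :: nat
  assumes "a > 0" "finite P" "\<And>p. p \<in> P \<Longrightarrow> prime p \<and> p dvd a"
  shows "(\<Sum>p\<in>P. ln (real p)) \<le> ln (real a)"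
proof -
  have "\<Prod>P dvd a"
    using assms(2,3)
  proof (induction P rule: finite_induct)
    case (insert q P)
    have "coprime q (\<Prod>P)"
      using insert by (intro prod_coprime_right primes_coprime) auto
    then show ?case
      using insert by (simp add: divides_mult)
  qed simp
  then have "\<Prod>P \<le> a"
    using assms(1) by (rule dvd_imp_le)
  moreover have pos: "p > 0" if "p \<in> P" for p
    using assms(3) that prime_gt_0_nat by blast
  moreover have "\<Prod>P > 0"
    using pos by (intro prod_pos) auto
  ultimately have "ln (real (\<Prod>P)) \<le> ln (real a)"
    using assms(1) by (subst ln_le_cancel_iff; simp only: of_nat_le_iff of_nat_0_less_iff)
  moreover have "ln (real (\<Prod>P)) = (\<Sum>p\<in>P. ln (real p))"
    using assms(2) pos by (simp add: ln_prod)
  ultimately show ?thesis by simp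
qed

text \<open>Erdos' induction. An even \<open>n > 2\<close> is not prime. For
  \<open>n = 2 * m + 1\<close>, the primes in \<open>(m + 1, n]\<close> divide
  \<open>n choose m\<close>, since they divide \<open>n!\<close> but neither \<open>m!\<close> nor
  \<open>(m + 1)!\<close>; they contribute at most \<open>m * ln 4\<close>, and the induction
  hypothesis at \<open>m + 1\<close> supplies the rest.\<close>

lemma chebyshev_theta_le:
  "(\<Sum>p | prime p \<and> p \<le> n. ln (real p)) \<le> real n * ln 4"
proof (induction n rule: less_induct)
  case (less n)
  consider "n \<le> 1" | "n = 2" | "n > 2" "even n" | m where "m \<ge> 1" "n = 2 * m + 1"
    by (cases "even n") (force elim!: oddE)+
  then show ?case
  proof cases
    case 1
    then have none: "{p. prime p \<and> p \<le> n} = {}"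
      by (auto dest: prime_gt_1_nat)
    show ?thesis unfolding none by simp
  next
    case 2
    then have "{p. prime p \<and> p \<le> n} = {2}"
      by (auto dest: prime_ge_2_nat intro: antisym)
    moreover have "ln 2 \<le> 2 * ln (4::real)"
      using ln_realpow[of 4 2] ln_le_cancel_iff[of 2 "4 ^ 2 :: real"] by simp
    ultimately show ?thesis using 2 by simp
  next
    case 3
    then have "\<not> prime n"
      using prime_odd_nat by blast
    then have pred: "{p. prime p \<and> p \<le> n} = {p. prime p \<and> p \<le> n - 1}"
      by (auto simp: le_less)
    have "real (n - 1) * ln 4 \<le> real n * ln 4"
      by (intro mult_right_mono) auto
    moreover have "(\<Sum>p | prime p \<and> p \<le> n - 1. ln (real p)) \<le> real (n - 1) * ln 4"
      using 3 by (intro less) auto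
    ultimately show ?thesis
      unfolding pred by linarith
  next
    case (4 m)
    let ?b = "(2 * m + 1) choose m"
    let ?Q = "{p. prime p \<and> m + 1 < p \<and> p \<le> 2 * m + 1}"
    have dvd: "p dvd ?b" if "p \<in> ?Q" for p
    proof -
      have "p dvd fact (2 * m + 1)"
        using that prime_dvd_fact_iff by blast
      also have "fact (2 * m + 1) = fact m * fact (m + 1) * ?b"
        using binomial_fact_lemma[of m "2 * m + 1"] by simp
      finally have "p dvd fact m \<or> p dvd fact (m + 1) \<or> p dvd ?b"
        using that prime_dvd_mult_iff by blast
      then show ?thesis
        using that prime_dvd_fact_iff[of p m] prime_dvd_fact_iff[of p "m + 1"] by auto
    qed
    \<comment> \<open>The two equal middle entries of the row save a factor 2 over the row sum
      \<open>2 * 4 ^ m\<close>; this makes the exponents \<open>m\<close> and \<open>m + 1\<close>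
      add up to exactly \<open>n\<close>.\<close>
    have "2 * ?b = (\<Sum>k\<in>{m, m + 1}. (2 * m + 1) choose k)"
      using binomial_symmetric[of m "2 * m + 1"] by simp
    also have "\<dots> \<le> (\<Sum>k\<le>2 * m + 1. (2 * m + 1) choose k)"
      by (intro sum_mono2) auto
    also have "\<dots> = 2 * 4 ^ m"
      by (simp only: choose_row_sum) (simp add: power_mult)
    finally have "?b \<le> 4 ^ m" by simp
    then have "real ?b \<le> 4 ^ m"
      by (metis of_nat_le_iff of_nat_numeral of_nat_power)
    moreover have "0 < real ?b" by simp
    ultimately have "ln (real ?b) \<le> ln (4 ^ m)"
      by (subst ln_le_cancel_iff) auto
    then have "ln (real ?b) \<le> real m * ln 4"
      by (simp add: ln_realpow)
    moreover have "(\<Sum>p\<in>?Q. ln (real p)) \<le> ln (real ?b)"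
      using dvd by (intro sum_ln_primes_dvd_le) auto
    moreover have "{p. prime p \<and> p \<le> n} = {p. prime p \<and> p \<le> m + 1} \<union> ?Q"
      using 4 by auto
    then have "(\<Sum>p | prime p \<and> p \<le> n. ln (real p)) =
        (\<Sum>p | prime p \<and> p \<le> m + 1. ln (real p)) + (\<Sum>p\<in>?Q. ln (real p))"
      by (simp only:) (subst sum.union_disjoint, auto)
    moreover have "(\<Sum>p | prime p \<and> p \<le> m + 1. ln (real p)) \<le> real (m + 1) * ln 4"
      using 4 by (intro less) auto
    ultimately show ?thesis
      using 4 by (simp add: algebra_simps)
  qed
qed

text \<open>On the block \<open>(n div 4, n]\<close> the weight \<open>1 / sqrt p\<close> is at most
  \<open>2 / sqrt n\<close>, so Chebyshev bounds the block by \<open>2 * ln 4 * sqrt n\<close>.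
  Passing to \<open>n div 4\<close> at least halves the inductive bound, and 4 solves
  \<open>K = K / 2 + 2\<close>.\<close>

lemma sum_ln_div_sqrt_primes_nat_le:
  "(\<Sum>p | prime p \<and> p \<le> n. ln (real p) / sqrt (real p)) \<le> 4 * ln 4 * sqrt (real n)"
proof (induction n rule: less_induct)
  case (less n)
  show ?case
  proof (cases "n = 0")
    case False
    let ?Q = "{p. prime p \<and> n div 4 < p \<and> p \<le> n}"
    have "(\<Sum>p\<in>?Q. ln (real p) / sqrt (real p)) \<le> (\<Sum>p\<in>?Q. ln (real p) / (sqrt (real n) / 2))"
    proof (intro sum_mono divide_left_mono)
      fix p assume p: "p \<in> ?Q"
      have "real n \<le> 4 * real p" using p by auto
      then have "sqrt (real n) \<le> sqrt (4 * real p)" by (rule real_sqrt_le_mono)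
      then show "sqrt (real n) / 2 \<le> sqrt (real p)" by (simp add: real_sqrt_mult)
      show "0 \<le> ln (real p)" "0 < sqrt (real p) * (sqrt (real n) / 2)"
        using p prime_gt_0_nat[of p] False by auto
    qed
    also have "\<dots> = (\<Sum>p\<in>?Q. ln (real p)) / (sqrt (real n) / 2)"
      by (simp only: sum_divide_distrib)
    also have "\<dots> \<le> (\<Sum>p | prime p \<and> p \<le> n. ln (real p)) / (sqrt (real n) / 2)"
      by (intro divide_right_mono sum_mono2) (auto dest: prime_gt_0_nat)
    also have "\<dots> \<le> real n * ln 4 / (sqrt (real n) / 2)"
      by (intro divide_right_mono chebyshev_theta_le) auto
    also have "\<dots> = 2 * ln 4 * sqrt (real n)"
      using False by (simp add: field_simps)
    finally have Q: "(\<Sum>p\<in>?Q. ln (real p) / sqrt (real p)) \<le> 2 * ln 4 * sqrt (real n)" .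
    have "real (n div 4) \<le> real n / 4"
      by linarith
    then have "sqrt (real (n div 4)) \<le> sqrt (real n / 4)"
      by (rule real_sqrt_le_mono)
    then have "4 * ln 4 * sqrt (real (n div 4)) \<le> 4 * ln 4 * (sqrt (real n) / 2)"
      by (intro mult_left_mono) (auto simp: real_sqrt_divide)
    moreover have "(\<Sum>p | prime p \<and> p \<le> n div 4. ln (real p) / sqrt (real p))
        \<le> 4 * ln 4 * sqrt (real (n div 4))"
      using False by (intro less) auto
    moreover have "{p. prime p \<and> p \<le> n} = {p. prime p \<and> p \<le> n div 4} \<union> ?Q"
      by (auto intro: le_trans div_le_dividend)
    then have "(\<Sum>p | prime p \<and> p \<le> n. ln (real p) / sqrt (real p)) =
        (\<Sum>p | prime p \<and> p \<le> n div 4. ln (real p) / sqrt (real p))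
        + (\<Sum>p\<in>?Q. ln (real p) / sqrt (real p))"
      by (simp only:) (subst sum.union_disjoint, auto)
    ultimately show ?thesis using Q by linarith
  qed auto
qed

lemma sum_ln_div_sqrt_primes_le:
  fixes x :: real
  assumes "x \<ge> 0"
  shows "(\<Sum>p | prime p \<and> real p \<le> x. ln (real p) / sqrt (real p)) \<le> 4 * ln 4 * sqrt x"
proof -
  have "{p. prime p \<and> real p \<le> x} = {p. prime p \<and> p \<le> nat \<lfloor>x\<rfloor>}"
    using assms by (auto simp: le_nat_iff le_floor_iff)
  then have "(\<Sum>p | prime p \<and> real p \<le> x. ln (real p) / sqrt (real p))
      \<le> 4 * ln 4 * sqrt (real (nat \<lfloor>x\<rfloor>))"
    by (simp only: sum_ln_div_sqrt_primes_nat_le)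
  also have "\<dots> \<le> 4 * ln 4 * sqrt x"
    using assms by (intro mult_left_mono real_sqrt_le_mono) auto
  finally show ?thesis .
qed

section \<open>Subset sums modulo a prime\<close>

text \<open>The orbit \<open>r + k * b\<close> for \<open>k < p\<close> stays in \<open>R\<close>
  and has \<open>p\<close> distinct residues: a coincidence would make \<open>p\<close> divide
  \<open>(l - k) * b\<close> with \<open>0 < l - k < p\<close>.\<close>

lemma closed_under_shift_mod_prime:
  fixes p b :: nat
  assumes "prime p" "\<not> p dvd b" "R \<subseteq> {..<p}" "R \<noteq> {}"
    and closed: "\<And>r. r \<in> R \<Longrightarrow> (r + b) mod p \<in> R"
  shows "R = {..<p}"
proof -
  obtain r where r: "r \<in> R" using assms(4) by blast
  have orbit: "(r + k * b) mod p \<in> R" for k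
  proof (induction k)
    case 0
    then show ?case using r assms(3) by auto
  next
    case (Suc k)
    have "((r + k * b) mod p + b) mod p = (r + k * b + b) mod p"
      by (rule mod_add_left_eq)
    then show ?case using closed[OF Suc] by (simp add: add_ac)
  qed
  have "inj_on (\<lambda>k. (r + k * b) mod p) {..<p}"
  proof (rule linorder_inj_onI)
    fix k l assume kl: "k < l" "k \<in> {..<p}" "l \<in> {..<p}"
    show "(r + k * b) mod p \<noteq> (r + l * b) mod p"
    proof
      assume "(r + k * b) mod p = (r + l * b) mod p"
      then have "p dvd (r + l * b) - (r + k * b)"
        using kl by (metis mod_eq_dvd_iff_nat add_le_mono le_refl mult_le_mono1 less_imp_le)
      also have "(r + l * b) - (r + k * b) = (l - k) * b"
        by (simp add: diff_mult_distrib)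
      finally have "p dvd l - k"
        using assms(1,2) prime_dvd_mult_iff by blast
      then show False using kl by (auto dest: dvd_imp_le)
    qed
  qed auto
  then have "card ((\<lambda>k. (r + k * b) mod p) ` {..<p}) = p"
    by (simp add: card_image)
  moreover have "(\<lambda>k. (r + k * b) mod p) ` {..<p} \<subseteq> R" using orbit by blast
  ultimately have "card {..<p} \<le> card R"
    using assms(3) by (metis card_mono card_lessThan finite_lessThan finite_subset)
  then show ?thesis
    using assms(3) by (intro card_seteq) auto
qed

text \<open>A case of Cauchy-Davenport, for sums of the sets \<open>{0, a i}\<close>. If a further
  step \<open>a x\<close> yields no new residue, the set reached so far is closed under the shift by
  \<open>a x\<close>, hence is everything; otherwise its size grows by at least one.\<close>

lemma card_subset_sums_mod_prime:
  fixes p a0 :: nat and a :: "'i \<Rightarrow> nat"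
  assumes "prime p" "finite I" "\<And>i. i \<in> I \<Longrightarrow> \<not> p dvd a i"
  shows "card ((\<lambda>J. (a0 + sum a J) mod p) ` Pow I) \<ge> min p (card I + 1)"
  using assms(2,3)
proof (induction I rule: finite_induct)
  case (insert x I)
  let ?f = "\<lambda>J. (a0 + sum a J) mod p"
  let ?R = "?f ` Pow I" and ?R' = "?f ` Pow (insert x I)"
  have fin: "finite ?R'" using insert by auto
  have sub: "?R \<subseteq> ?R'" by auto
  have lt: "?R \<subseteq> {..<p}" using assms(1) prime_gt_0_nat by auto
  \<comment> \<open>As \<open>x\<close> is not in \<open>J\<close>, adjoining it to \<open>J\<close>
    realises the shift.\<close>
  have shift: "(r + a x) mod p \<in> ?R'" if r: "r \<in> ?R" for r
  proof -
    from r obtain J where J: "r = ?f J" "J \<in> Pow I" by (rule imageE)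
    then have "finite J" "x \<notin> J" using insert.hyps by (auto dest: finite_subset)
    then have "?f (insert x J) = (a0 + sum a J + a x) mod p"
      by (simp add: add_ac)
    also have "\<dots> = (r + a x) mod p"
      unfolding J(1) by (rule mod_add_left_eq[symmetric])
    finally show ?thesis
      using J(2) by (intro image_eqI[of _ _ "insert x J"]) auto
  qed
  show ?case
  proof (cases "?R' = ?R")
    case True
    have "?R = {..<p}"
      using assms(1) insert.prems[of x] lt shift
      unfolding True by (intro closed_under_shift_mod_prime[of p "a x"]) auto
    then show ?thesis using True by simp
  next
    case False
    then have "card ?R < card ?R'"
      using fin sub by (intro psubset_card_mono) auto
    moreover have "card ?R \<ge> min p (card I + 1)"
      using insert by blast
    ultimately show ?thesis using insert by simp
  qed
qed (use assms(1) in auto)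

text \<open>With \<open>p\<close> such steps the subset sums would fill all residues, so some cube
  element would be divisible by \<open>p\<close>, contradicting \<open>p \<notin> T\<close>.\<close>

lemma card_steps_not_dvd_less:
  assumes "prime p" "p \<notin> T" "hilbert_cube a0 a d \<subseteq> smooth_set T"
  shows "card {i\<in>{1..d}. \<not> p dvd a i} < p"
proof (rule ccontr)
  let ?I = "{i\<in>{1..d}. \<not> p dvd a i}"
  let ?R = "(\<lambda>J. (a0 + sum a J) mod p) ` Pow ?I"
  assume "\<not> ?thesis"
  moreover have "min p (card ?I + 1) \<le> card ?R"
    using assms(1) by (intro card_subset_sums_mod_prime) auto
  ultimately have "card {..<p} \<le> card ?R"
    unfolding card_lessThan by linarith
  moreover have "?R \<subseteq> {..<p}"
    using prime_gt_0_nat[OF assms(1)] by auto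
  ultimately have "?R = {..<p}"
    by (intro card_seteq finite_lessThan)
  then have "0 \<in> ?R"
    using prime_gt_0_nat[OF assms(1)] by blast
  then obtain J where J: "0 = (a0 + sum a J) mod p" "J \<in> Pow ?I"
    by (rule imageE)
  from J(2) have "a0 + sum a J \<in> hilbert_cube a0 a d"
    unfolding hilbert_cube_def by blast
  moreover have "p dvd a0 + sum a J"
    using J(1) by (metis dvd_eq_mod_eq_0)
  ultimately show False
    using assms unfolding smooth_set_def by blast
qed

section \<open>Double counting of prime divisors of the steps\<close>

lemma sum_ln_primes_not_in_le:
  assumes "d \<in> cube_dims T N" "d > 0" "finite P"
    and P: "\<And>p. p \<in> P \<Longrightarrow> prime p \<and> p \<notin> T \<and> 2 * p \<le> d"
  shows "(\<Sum>p\<in>P. ln (real p)) \<le> 2 * ln (real N)"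
proof -
  obtain a0 a where pos: "\<And>i. i \<in> {1..d} \<Longrightarrow> a i > 0"
    and cube: "hilbert_cube a0 a d \<subseteq> smooth_set T \<inter> {1..N}"
    using assms(1) unfolding cube_dims_def by blast
  have le: "a i \<le> N" if "i \<in> {1..d}" for i
  proof -
    have "a0 + sum a {i} \<in> hilbert_cube a0 a d"
      unfolding hilbert_cube_def using that by blast
    then show ?thesis using cube by auto
  qed
  have half: "real d / 2 \<le> real (card {i\<in>{1..d}. p dvd a i})" if "p \<in> P" for p
  proof -
    have "card {i\<in>{1..d}. \<not> p dvd a i} < p"
      using P[OF that] cube by (intro card_steps_not_dvd_less[of p T a0]) auto
    moreover have "card {i\<in>{1..d}. p dvd a i} + card {i\<in>{1..d}. \<not> p dvd a i}
        = card ({i\<in>{1..d}. p dvd a i} \<union> {i\<in>{1..d}. \<not> p dvd a i})"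
      by (intro card_Un_disjoint[symmetric]) auto
    moreover have "{i\<in>{1..d}. p dvd a i} \<union> {i\<in>{1..d}. \<not> p dvd a i} = {1..d}" by blast
    ultimately show ?thesis using P[OF that] by simp
  qed
  \<comment> \<open>The pairs \<open>(p, i)\<close> with \<open>p dvd a i\<close> are counted with
    weight \<open>ln p\<close>: each \<open>p\<close> occurs for at least \<open>d / 2\<close>
    indices, while each \<open>i\<close> receives total weight at most
    \<open>ln (a i)\<close>.\<close>
  have "real d / 2 * (\<Sum>p\<in>P. ln (real p))
      \<le> (\<Sum>p\<in>P. real (card {i\<in>{1..d}. p dvd a i}) * ln (real p))"
    unfolding sum_distrib_left using half P
    by (intro sum_mono mult_right_mono) (auto dest!: P prime_gt_0_nat)
  also have "\<dots> = (\<Sum>p\<in>P. \<Sum>i | i \<in> {1..d} \<and> p dvd a i. ln (real p))"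
    by simp
  also have "\<dots> = (\<Sum>i\<in>{1..d}. \<Sum>p | p \<in> P \<and> p dvd a i. ln (real p))"
    using assms(3) by (intro sum.swap_restrict) auto
  also have "\<dots> \<le> (\<Sum>i\<in>{1..d}. ln (real N))"
  proof (intro sum_mono)
    fix i assume i: "i \<in> {1..d}"
    have "(\<Sum>p | p \<in> P \<and> p dvd a i. ln (real p)) \<le> ln (real (a i))"
      using assms(3) P pos[OF i] by (intro sum_ln_primes_dvd_le) auto
    also have "\<dots> \<le> ln (real N)"
      using pos[OF i] le[OF i] by simp
    finally show "(\<Sum>p | p \<in> P \<and> p dvd a i. ln (real p)) \<le> ln (real N)" .
  qed
  also have "\<dots> = real d / 2 * (2 * ln (real N))" by simp
  finally show ?thesis using assms(2) by simp
qed

section \<open>From the weighted prime sum to the sum of logarithms\<close>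

text \<open>
  By Chebyshev the primes up to \<open>s\<^sup>2 y\<close>, \<open>s = b / (8 ln 4)\<close>, account for at most half of the
  lower bound \<open>b * sqrt y\<close>; on the remaining ones \<open>1 / sqrt p \<le> 1 / (s * sqrt y)\<close>.
\<close>
lemma sum_ln_ge_of_sum_ln_div_sqrt_ge:
  fixes b y :: real
  assumes "b > 0" "y > 0"
    and ge: "(\<Sum>p | prime p \<and> p \<notin> T \<and> real p \<le> y. ln (real p) / sqrt (real p)) \<ge> b * sqrt y"
  shows "(\<Sum>p | prime p \<and> p \<notin> T \<and> real p \<le> y. ln (real p)) \<ge> b\<^sup>2 / (16 * ln 4) * y"
proof -
  \<comment> \<open>Chosen so that \<open>4 * ln 4 * s = b / 2\<close>, with \<open>4 * ln 4\<close>
    the constant of \<open>sum_ln_div_sqrt_primes_le\<close>.\<close>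
  define s where "s = b / (8 * ln 4)"
  have s: "s > 0" using assms(1) by (simp add: s_def)
  let ?P = "{p. prime p \<and> p \<notin> T \<and> real p \<le> y}"
  let ?A = "{p\<in>?P. real p \<le> s\<^sup>2 * y}" and ?B = "{p\<in>?P. \<not> real p \<le> s\<^sup>2 * y}"
  have fin: "finite {p. prime p \<and> real p \<le> z}" for z :: real
    by (rule finite_subset[of _ "{..nat \<lfloor>z\<rfloor>}"]) (auto simp: le_nat_floor)
  have finP: "finite ?P"
    by (rule finite_subset[OF _ fin[of y]]) auto
  have sqrt: "sqrt (s\<^sup>2 * y) = s * sqrt y"
    using s by (simp add: real_sqrt_mult)
  have "(\<Sum>p\<in>?A. ln (real p) / sqrt (real p))
      \<le> (\<Sum>p | prime p \<and> real p \<le> s\<^sup>2 * y. ln (real p) / sqrt (real p))"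
    by (intro sum_mono2 fin) (auto dest: prime_gt_0_nat)
  also have "\<dots> \<le> 4 * ln 4 * sqrt (s\<^sup>2 * y)"
    using assms(2) by (intro sum_ln_div_sqrt_primes_le) auto
  also have "\<dots> = b / 2 * sqrt y"
    unfolding sqrt by (simp add: s_def)
  finally have A: "(\<Sum>p\<in>?A. ln (real p) / sqrt (real p)) \<le> b / 2 * sqrt y" .
  have "(\<Sum>p\<in>?B. ln (real p) / sqrt (real p)) \<le> (\<Sum>p\<in>?B. ln (real p) / (s * sqrt y))"
  proof (intro sum_mono divide_left_mono)
    fix p assume p: "p \<in> ?B"
    then have "sqrt (s\<^sup>2 * y) \<le> sqrt (real p)" by (intro real_sqrt_le_mono) auto
    then show "s * sqrt y \<le> sqrt (real p)" unfolding sqrt .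
    show "0 \<le> ln (real p)" "0 < sqrt (real p) * (s * sqrt y)"
      using p prime_gt_0_nat[of p] s assms(2) by auto
  qed
  also have "\<dots> = (\<Sum>p\<in>?B. ln (real p)) / (s * sqrt y)"
    by (simp only: sum_divide_distrib)
  \<comment> \<open>The small primes are put back; their logarithms are nonnegative.\<close>
  also have "\<dots> \<le> (\<Sum>p\<in>?P. ln (real p)) / (s * sqrt y)"
    using s assms(2) by (intro divide_right_mono sum_mono2 finP) (auto dest: prime_gt_0_nat)
  finally have B: "(\<Sum>p\<in>?B. ln (real p) / sqrt (real p)) \<le> (\<Sum>p\<in>?P. ln (real p)) / (s * sqrt y)" .
  have "?P = ?A \<union> ?B" by blast
  then have "(\<Sum>p\<in>?P. ln (real p) / sqrt (real p)) =
      (\<Sum>p\<in>?A. ln (real p) / sqrt (real p)) + (\<Sum>p\<in>?B. ln (real p) / sqrt (real p))"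
    using finP by (metis (no_types, lifting) sum.union_disjoint
        finite_Un disjoint_iff mem_Collect_eq)
  with A B ge have "b / 2 * sqrt y \<le> (\<Sum>p\<in>?P. ln (real p)) / (s * sqrt y)"
    by linarith
  then have "b / 2 * sqrt y * (s * sqrt y) \<le> (\<Sum>p\<in>?P. ln (real p))"
    using s assms(2) by (simp add: pos_le_divide_eq)
  also have "b / 2 * sqrt y * (s * sqrt y) = b / 2 * s * (sqrt y * sqrt y)"
    by (simp only: ac_simps)
  also have "\<dots> = b\<^sup>2 / (16 * ln 4) * y"
    using assms(2) by (simp add: s_def power2_eq_square)
  finally show ?thesis .
qed

theorem theorem1p9:
  fixes \<tau> :: real and c :: "real \<Rightarrow> real" and T :: "nat set"
  assumes "0 < \<tau>" and "\<tau> \<le> 1"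
    and "\<And>p. p \<in> T \<Longrightarrow> prime p"
    and "c \<tau> > 0"
    and "\<forall>\<^sub>F (y::real) in at_top.
           (\<Sum>p | prime p \<and> p \<notin> T \<and> real p \<le> y. ln (real p) / sqrt (real p)) \<ge> c \<tau> * sqrt y"
  shows "\<exists>C>0. \<forall>\<^sub>F N in sequentially. real (F4 T N) \<le> C * ln (real N)"
proof -
  obtain Y where Y: "\<And>y. y \<ge> Y \<Longrightarrow> c \<tau> * sqrt y \<le>
      (\<Sum>p | prime p \<and> p \<notin> T \<and> real p \<le> y. ln (real p) / sqrt (real p))"
    using assms(5) unfolding eventually_at_top_linorder by blast
  define k where "k = (c \<tau>)\<^sup>2 / (16 * ln 4)"
  have k: "k > 0" using assms(4) by (simp add: k_def)
  \<comment> \<open>The first entry covers \<open>d / 2 < Y\<close>, where the hypothesis on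
    \<open>T\<close> says nothing yet; the second comes from solving
    \<open>k * (d / 2) \<le> 2 * ln N\<close> for \<open>d\<close>.\<close>
  define C where "C = max (2 * \<bar>Y\<bar> + 1) (4 / k)"
  have C: "C > 0" "2 * \<bar>Y\<bar> \<le> C" "4 / k \<le> C"
    by (auto simp: C_def)
  \<comment> \<open>From \<open>N = 3 > exp 1\<close> on, \<open>ln N \<ge> 1\<close>, so a constant
    bound on \<open>d\<close> is also a bound by \<open>C * ln N\<close>.\<close>
  have main: "real (F4 T N) \<le> C * ln (real N)" if N: "N \<ge> 3" for N
  proof -
    define d where "d = F4 T N"
    have d: "d \<in> cube_dims T N"
      unfolding d_def F4_def using N finite_cube_dims[of T N] zero_in_cube_dims[of N T]
      by (intro Max_in) auto
    have "exp 1 \<le> real N"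
      using exp_le N by linarith
    then have ln: "ln (real N) \<ge> 1"
      using N by (simp add: ln_ge_iff)
    have "real d \<le> C * ln (real N)"
    proof (cases "d = 0 \<or> real d / 2 < Y")
      case True
      then have "real d \<le> C" using C by auto
      also have "C \<le> C * ln (real N)" using C ln by simp
      finally show ?thesis .
    next
      case False
      \<comment> \<open>The cut-off \<open>y = d / 2\<close> is exactly the condition
        \<open>2 * p \<le> d\<close> of the double counting.\<close>
      let ?P = "{p. prime p \<and> p \<notin> T \<and> real p \<le> real d / 2}"
      have "finite ?P"
        by (rule finite_subset[of _ "{..d}"]) auto
      have "k * (real d / 2) \<le> (\<Sum>p\<in>?P. ln (real p))"
        unfolding k_def using assms(4) False Y[of "real d / 2"]
        by (intro sum_ln_ge_of_sum_ln_div_sqrt_ge) auto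
      also have "\<dots> \<le> 2 * ln (real N)"
        using d False \<open>finite ?P\<close> by (intro sum_ln_primes_not_in_le[of d T]) auto
      finally have "real d \<le> 4 / k * ln (real N)"
        using k by (simp add: field_simps)
      also have "\<dots> \<le> C * ln (real N)"
        using C ln by (intro mult_right_mono) auto
      finally show ?thesis .
    qed
    then show ?thesis by (simp add: d_def)
  qed
  then have "\<forall>\<^sub>F N in sequentially. real (F4 T N) \<le> C * ln (real N)"
    by (intro eventually_sequentiallyI[of 3]) auto
  then show ?thesis using C by blast
qed

end
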